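(* The program $P_3$ is correct with respect to $S_3$ and complete with respect to $S_3^0$; that is, $S_3^0\subseteq \mathcal{M}_{P_3}\subseteq S_3$, where $\mathcal{M}_{P_3}$ is the least Herbrand model of $P_3$.
   Context: A fixed alphabet of function and predicate symbols is assumed, containing at least those occurring below (it may contain more); $\mathcal{HU}$ is the Herbrand universe (all ground terms), $\mathcal{HB}$ the Herbrand base (all ground atoms). Prolog list notation is used ($[\,]$ is a constant, $[h|t]$ a binary constructor, $[t_1,\ldots,t_i|s]$ as usual); $-$ is a binary function symbol written infix; $\mathtt{true},\mathtt{false}$ are constants. A specification is a subset $S$ of $\mathcal{HB}$; a program $P$ is correct w.r.t. $S$ if $\mathcal{M}_P\subseteq S$, and complete w.r.t. $S$ if $S\subseteq\mathcal{M}_P$. The definite clause program $P_3$ consists of the following rules (names beginning with upper-case letters are variables): 1. $sat\_cnf([\,])$. 2. $sat\_cnf([C|Cs])\gets sat\_cl(C), sat\_cnf(Cs)$. 3. $sat\_cl([P-V|R])\gets sat\_cl3(R,V,P)$. 4. ${=}(X,X)$. 5. $sat\_cl3([\,],V,P)\gets V=P$. 6. $sat\_cl3([P_2-V_2|R],V_1,P_1)\gets sat\_cl5(V_1,P_1,V_2,P_2,R)$. 7. $sat\_cl5(V_1,P_1,V_2,P_2,R)\gets sat\_cl5a(V_1,P_1,V_2,P_2,R)$. 8. $sat\_cl5(V_1,P_1,V_2,P_2,R)\gets sat\_cl5a(V_2,P_2,V_1,P_1,R)$. 9. $sat\_cl5a(V_1,P_1,V_2,P_2,R)\gets V_1=P_1$.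 10. $sat\_cl5a(V_1,P_1,V_2,P_2,R)\gets sat\_cl3(R,V_2,P_2)$. 11. $sat(Cs,Vs)\gets sat\_cnf(Cs), tflist(Vs)$. 12. $tflist([\,])$. 13. $tflist([V|Vs])\gets tflist(Vs), tf(V)$. 14. $tf(\mathtt{true})$. 15. $tf(\mathtt{false})$. Define the sets of ground terms $L_1=\{[t_1,\ldots,t_i|s]\in\mathcal{HU}\mid i>0,\ t_i=t-t\text{ for some }t\in\mathcal{HU}\}$, $L_2=\{[s_1,\ldots,s_n]\mid n\ge0,\ s_1,\ldots,s_n\in L_1\}$, $L_1^0=\{[t_1-t'_1,\ldots,t_n-t'_n]\in\mathcal{HU}\mid n>0,\ t_i=t'_i\text{ for some }i\in\{1,\ldots,n\}\}$, $L_2^0=\{[s_1,\ldots,s_n]\mid n\ge0,\ s_1,\ldots,s_n\in L_1^0\}$, $TFL=\{[t_1,\ldots,t_n]\mid n\ge0,\ \text{each }t_i\in\{\mathtt{true},\mathtt{false}\}\}$. The specification $S_3$ (for correctness) consists of the following ground atoms: $sat\_cl(s)$ for $s\in L_1$; $sat\_cnf(u)$ for $u\in L_2$; $t=t$ for $t\in\mathcal{HU}$; $sat\_cl3(s,v,p)$ for $[p-v|s]\in L_1$; $sat\_cl5(v_1,p_1,v_2,p_2,s)$ and $sat\_cl5a(v_1,p_1,v_2,p_2,s)$ for $[p_1-v_1,p_2-v_2|s]\in L_1$; $sat(u,t)$ for $u\in L_2$, $t\in TFL$; $tflist(t)$ for $t\in TFL$; $tf(\mathtt{true})$ and $tf(\mathtt{false})$.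 The specification $S_3^0$ (for completeness) is defined in the same way with $L_1,L_2$ replaced by $L_1^0,L_2^0$. *)

theory Defs
  imports Main
begin

section \<open>Terms, atoms and definite clause programs\<close>

text \<open>
  The function symbols occurring in the program are constructors of their own, so they are
  pairwise distinct; \<open>Other_fun\<close> supplies the names of all further function symbols. The same
  is done for predicate symbols. Variables are named by strings.
\<close>

datatype 'f fsym = Nil_fun | Cons_fun | Minus_fun | True_fun | False_fun | Other_fun 'f

datatype 'p psym =
    Sat_cnf | Sat_cl | Sat_cl3 | Sat_cl5 | Sat_cl5a | Sat | Tflist | Tf | Equal
  | Other_pred 'p

datatype 'f trm = Var string | Fun "'f fsym" "'f trm list"

datatype ('p, 'f) atom = Atom "'p psym" "'f trm list"

datatype ('p, 'f) clause =
  Clause (head: "('p, 'f) atom") (body: "('p, 'f) atom list")  (infix "\<Longleftarrow>" 55)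

type_synonym ('p, 'f) program = "('p, 'f) clause set"

text \<open>
  An alphabet is a set \<open>F\<close> of function symbols and a set \<open>Q\<close> of predicate symbols, each symbol
  paired with an arity.
\<close>

inductive_set HU :: "('f fsym \<times> nat) set \<Rightarrow> 'f trm set"
  for F :: "('f fsym \<times> nat) set" where
  "(f, length ts) \<in> F \<Longrightarrow> (\<And>t. t \<in> set ts \<Longrightarrow> t \<in> HU F) \<Longrightarrow> Fun f ts \<in> HU F"

definition HB :: "('f fsym \<times> nat) set \<Rightarrow> ('p psym \<times> nat) set \<Rightarrow> ('p, 'f) atom set" where
  "HB F Q = {Atom p ts | p ts. (p, length ts) \<in> Q \<and> set ts \<subseteq> HU F}"

primrec subst :: "(string \<Rightarrow> 'f trm) \<Rightarrow> 'f trm \<Rightarrow> 'f trm" where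
  "subst \<theta> (Var x) = \<theta> x"
| "subst \<theta> (Fun f ts) = Fun f (map (subst \<theta>) ts)"

primrec subst_atom :: "(string \<Rightarrow> 'f trm) \<Rightarrow> ('p, 'f) atom \<Rightarrow> ('p, 'f) atom" where
  "subst_atom \<theta> (Atom p ts) = Atom p (map (subst \<theta>) ts)"

definition ground_instances ::
    "('f fsym \<times> nat) set \<Rightarrow> ('p, 'f) program \<Rightarrow> ('p, 'f) program" where
  "ground_instances F P =
     {subst_atom \<theta> (head c) \<Longleftarrow> map (subst_atom \<theta>) (body c) | \<theta> c. c \<in> P \<and> range \<theta> \<subseteq> HU F}"

definition herbrand_model ::
    "('f fsym \<times> nat) set \<Rightarrow> ('p psym \<times> nat) set \<Rightarrow> ('p, 'f) program \<Rightarrow> ('p, 'f) atom set \<Rightarrow> bool"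
where
  "herbrand_model F Q P I \<longleftrightarrow>
     I \<subseteq> HB F Q \<and> (\<forall>c \<in> ground_instances F P. set (body c) \<subseteq> I \<longrightarrow> head c \<in> I)"

text \<open>
  For a program over the alphabet, \<open>HB F Q\<close> is itself a Herbrand model, so the intersection
  is not over the empty family.
\<close>

definition least_herbrand_model ::
    "('f fsym \<times> nat) set \<Rightarrow> ('p psym \<times> nat) set \<Rightarrow> ('p, 'f) program \<Rightarrow> ('p, 'f) atom set" where
  "least_herbrand_model F Q P = \<Inter> {I. herbrand_model F Q P I}"

definition correct_wrt ::
    "('f fsym \<times> nat) set \<Rightarrow> ('p psym \<times> nat) set \<Rightarrow> ('p, 'f) program \<Rightarrow> ('p, 'f) atom set \<Rightarrow> bool"
where
  "correct_wrt F Q P S \<longleftrightarrow> least_herbrand_model F Q P \<subseteq> S"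

definition complete_wrt ::
    "('f fsym \<times> nat) set \<Rightarrow> ('p psym \<times> nat) set \<Rightarrow> ('p, 'f) program \<Rightarrow> ('p, 'f) atom set \<Rightarrow> bool"
where
  "complete_wrt F Q P S \<longleftrightarrow> S \<subseteq> least_herbrand_model F Q P"

section \<open>Term notation\<close>

abbreviation nil_t :: "'f trm" where
  "nil_t \<equiv> Fun Nil_fun []"

abbreviation cons_t :: "'f trm \<Rightarrow> 'f trm \<Rightarrow> 'f trm"  (infixr "\<bullet>" 65) where
  "h \<bullet> t \<equiv> Fun Cons_fun [h, t]"

abbreviation minus_t :: "'f trm \<Rightarrow> 'f trm \<Rightarrow> 'f trm"  (infix "\<ominus>" 70) where
  "s \<ominus> t \<equiv> Fun Minus_fun [s, t]"

abbreviation true_t :: "'f trm" where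
  "true_t \<equiv> Fun True_fun []"

abbreviation false_t :: "'f trm" where
  "false_t \<equiv> Fun False_fun []"

text \<open>\<open>plist [t1, ..., tn] s\<close> is the Prolog term \<open>[t1, ..., tn | s]\<close>.\<close>

definition plist :: "'f trm list \<Rightarrow> 'f trm \<Rightarrow> 'f trm" where
  "plist ts s = foldr (\<bullet>) ts s"

definition plists_of :: "'f trm set \<Rightarrow> 'f trm set" where
  "plists_of A = {plist ts nil_t | ts. set ts \<subseteq> A}"

section \<open>The program\<close>

definition P3_fsyms :: "('f fsym \<times> nat) set" where
  "P3_fsyms = {(Nil_fun, 0), (Cons_fun, 2), (Minus_fun, 2), (True_fun, 0), (False_fun, 0)}"

definition P3_psyms :: "('p psym \<times> nat) set" where
  "P3_psyms =
     {(Sat_cnf, 1), (Sat_cl, 1), (Sat_cl3, 3), (Sat_cl5, 5), (Sat_cl5a, 5),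
      (Sat, 2), (Tflist, 1), (Tf, 1), (Equal, 2)}"

definition P3 :: "('p, 'f) program" where
  "P3 =
    (let V = Var ''V''; V1 = Var ''V1''; V2 = Var ''V2'';
         P = Var ''P''; P1 = Var ''P1''; P2 = Var ''P2'';
         C = Var ''C''; Cs = Var ''Cs''; Vs = Var ''Vs''; R = Var ''R''; X = Var ''X''
     in {
       Atom Sat_cnf [nil_t] \<Longleftarrow> [],
       Atom Sat_cnf [C \<bullet> Cs] \<Longleftarrow> [Atom Sat_cl [C], Atom Sat_cnf [Cs]],
       Atom Sat_cl [(P \<ominus> V) \<bullet> R] \<Longleftarrow> [Atom Sat_cl3 [R, V, P]],
       Atom Equal [X, X] \<Longleftarrow> [],
       Atom Sat_cl3 [nil_t, V, P] \<Longleftarrow> [Atom Equal [V, P]],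
       Atom Sat_cl3 [(P2 \<ominus> V2) \<bullet> R, V1, P1] \<Longleftarrow> [Atom Sat_cl5 [V1, P1, V2, P2, R]],
       Atom Sat_cl5 [V1, P1, V2, P2, R] \<Longleftarrow> [Atom Sat_cl5a [V1, P1, V2, P2, R]],
       Atom Sat_cl5 [V1, P1, V2, P2, R] \<Longleftarrow> [Atom Sat_cl5a [V2, P2, V1, P1, R]],
       Atom Sat_cl5a [V1, P1, V2, P2, R] \<Longleftarrow> [Atom Equal [V1, P1]],
       Atom Sat_cl5a [V1, P1, V2, P2, R] \<Longleftarrow> [Atom Sat_cl3 [R, V2, P2]],
       Atom Sat [Cs, Vs] \<Longleftarrow> [Atom Sat_cnf [Cs], Atom Tflist [Vs]],
       Atom Tflist [nil_t] \<Longleftarrow> [],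
       Atom Tflist [V \<bullet> Vs] \<Longleftarrow> [Atom Tflist [Vs], Atom Tf [V]],
       Atom Tf [true_t] \<Longleftarrow> [],
       Atom Tf [false_t] \<Longleftarrow> []
     })"

section \<open>The specifications\<close>

definition L1 :: "('f fsym \<times> nat) set \<Rightarrow> 'f trm set" where
  "L1 F = {plist ts s | ts s.
     plist ts s \<in> HU F \<and> ts \<noteq> [] \<and> (\<exists>t \<in> HU F. last ts = t \<ominus> t)}"

definition L2 :: "('f fsym \<times> nat) set \<Rightarrow> 'f trm set" where
  "L2 F = plists_of (L1 F)"

definition L1_0 :: "('f fsym \<times> nat) set \<Rightarrow> 'f trm set" where
  "L1_0 F = {plist (map (\<lambda>(t, t'). t \<ominus> t') ps) nil_t | ps.
     plist (map (\<lambda>(t, t'). t \<ominus> t') ps) nil_t \<in> HU F \<and> ps \<noteq> [] \<and>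
     (\<exists>(t, t') \<in> set ps. t = t')}"

definition L2_0 :: "('f fsym \<times> nat) set \<Rightarrow> 'f trm set" where
  "L2_0 F = plists_of (L1_0 F)"

definition TFL :: "'f trm set" where
  "TFL = plists_of {true_t, false_t}"

text \<open>The common shape of the two specifications, with \<open>A\<close>, \<open>B\<close> in the roles of
  \<open>L1\<close>, \<open>L2\<close>.\<close>

definition spec :: "('f fsym \<times> nat) set \<Rightarrow> 'f trm set \<Rightarrow> 'f trm set \<Rightarrow> ('p, 'f) atom set" where
  "spec F A B =
     {Atom Sat_cl [s] | s. s \<in> A} \<union>
     {Atom Sat_cnf [u] | u. u \<in> B} \<union>
     {Atom Equal [t, t] | t. t \<in> HU F} \<union>
     {Atom Sat_cl3 [s, v, p] | s v p. (p \<ominus> v) \<bullet> s \<in> A} \<union>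
     {Atom Sat_cl5 [v1, p1, v2, p2, s] | v1 p1 v2 p2 s.
        (p1 \<ominus> v1) \<bullet> (p2 \<ominus> v2) \<bullet> s \<in> A} \<union>
     {Atom Sat_cl5a [v1, p1, v2, p2, s] | v1 p1 v2 p2 s.
        (p1 \<ominus> v1) \<bullet> (p2 \<ominus> v2) \<bullet> s \<in> A} \<union>
     {Atom Sat [u, t] | u t. u \<in> B \<and> t \<in> TFL} \<union>
     {Atom Tflist [t] | t. t \<in> TFL} \<union>
     {Atom Tf [true_t], Atom Tf [false_t]}"

definition S3 :: "('f fsym \<times> nat) set \<Rightarrow> ('p, 'f) atom set" where
  "S3 F = spec F (L1 F) (L2 F)"

definition S3_0 :: "('f fsym \<times> nat) set \<Rightarrow> ('p, 'f) atom set" where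
  "S3_0 F = spec F (L1_0 F) (L2_0 F)"

end

theory Submission
  imports Defs
begin

text \<open>
  Correctness: \<open>S3\<close> is itself a Herbrand model of the program, because \<open>L1\<close> is closed under
  swapping the first two elements of a list and under adding a first element.
  Completeness: the atoms of \<open>S3_0\<close> for \<open>sat_cl3\<close> lie in every Herbrand model, by induction on
  the list argument; rule 7 suffices for this, without the symmetric rule 8.
\<close>

section \<open>Ground terms\<close>

lemma Fun_in_HU_iff: "Fun f ts \<in> HU F \<longleftrightarrow> (f, length ts) \<in> F \<and> set ts \<subseteq> HU F"
  by (auto intro: HU.intros elim: HU.cases)

lemma P3_fsyms_HU:
  assumes "P3_fsyms \<subseteq> F"
  shows "nil_t \<in> HU F" "true_t \<in> HU F" "false_t \<in> HU F"
    "s \<bullet> t \<in> HU F \<longleftrightarrow> s \<in> HU F \<and> t \<in> HU F"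
    "s \<ominus> t \<in> HU F \<longleftrightarrow> s \<in> HU F \<and> t \<in> HU F"
  using assms by (auto simp: Fun_in_HU_iff P3_fsyms_def eval_nat_numeral)

lemma plist_simps [simp]: "plist [] s = s" "plist (t # ts) s = t \<bullet> plist ts s"
  by (simp_all add: plist_def)

lemma plist_in_HU_iff:
  assumes "P3_fsyms \<subseteq> F"
  shows "plist ts s \<in> HU F \<longleftrightarrow> set ts \<subseteq> HU F \<and> s \<in> HU F"
  using assms by (induction ts) (auto simp: P3_fsyms_HU)

lemma nil_in_plists_of: "nil_t \<in> plists_of A"
  by (auto simp: plists_of_def intro!: exI[of _ "[]"])

lemma cons_in_plists_of: "t \<in> A \<Longrightarrow> s \<in> plists_of A \<Longrightarrow> t \<bullet> s \<in> plists_of A"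
  unfolding plists_of_def using plist_simps(2) by (smt (verit) insert_subset list.simps(15) mem_Collect_eq)

text \<open>\<open>plists_of\<close> is given through HOL lists, while the clauses for
  \<open>Sat_cnf\<close> and \<open>Tflist\<close> build terms one \<open>\<bullet>\<close> at a
  time; this induction bridges the two.\<close>

lemma plists_of_induct [consumes 1, case_names nil cons]:
  assumes "t \<in> plists_of A" "P nil_t"
    and "\<And>s t. s \<in> A \<Longrightarrow> t \<in> plists_of A \<Longrightarrow> P t \<Longrightarrow> P (s \<bullet> t)"
  shows "P t"
proof -
  have "P (plist ts nil_t)" if "set ts \<subseteq> A" for ts
    using that
  proof (induction ts)
    case Nil
    then show ?case using assms(2) by simp
  next
    case (Cons t ts)
    then have "plist ts nil_t \<in> plists_of A" by (auto simp: plists_of_def)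
    then show ?case using Cons assms(3) by simp
  qed
  then show ?thesis using assms(1) by (auto simp: plists_of_def)
qed

lemma plists_of_subset_HU:
  assumes "P3_fsyms \<subseteq> F" "A \<subseteq> HU F"
  shows "plists_of A \<subseteq> HU F"
  using assms by (auto simp: plists_of_def plist_in_HU_iff P3_fsyms_HU)

lemma L1_subset_HU: "L1 F \<subseteq> HU F"
  by (auto simp: L1_def)

text \<open>A prefix ending in \<open>t \<ominus> t\<close> either is just \<open>x\<close> or
  continues into \<open>s\<close> after \<open>x\<close>. The resulting disjunction is symmetric in
  two leading elements and survives a new ground element in front, the two closure properties behind
  correctness.\<close>

lemma cons_in_L1_iff:
  assumes "P3_fsyms \<subseteq> F"
  shows "x \<bullet> s \<in> L1 F \<longleftrightarrow>
    x \<in> HU F \<and> s \<in> HU F \<and> ((\<exists>t \<in> HU F. x = t \<ominus> t) \<or> s \<in> L1 F)" (is "?l \<longleftrightarrow> ?r")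
proof
  assume ?l
  then obtain ts r t where *: "x \<bullet> s = plist ts r" "plist ts r \<in> HU F" "ts \<noteq> []"
      "t \<in> HU F" "last ts = t \<ominus> t"
    unfolding L1_def by blast
  then obtain us where us: "ts = x # us" "s = plist us r"
    by (cases ts) auto
  have "x \<in> HU F" "s \<in> HU F"
    using * us P3_fsyms_HU(4)[OF assms] by auto
  moreover have "s \<in> L1 F" if "us \<noteq> []"
    using * us that \<open>s \<in> HU F\<close> unfolding L1_def by auto
  ultimately show ?r using *(4,5) us(1) by (cases "us = []") auto
next
  assume r: ?r
  then have HU: "x \<bullet> s \<in> HU F" using P3_fsyms_HU(4)[OF assms] by blast
  from r consider t where "t \<in> HU F" "x = t \<ominus> t" | "s \<in> L1 F" by blast
  then show ?l
  proof cases
    case 1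
    then show ?thesis unfolding L1_def using HU
      by (auto intro!: exI[of _ "[x]"] exI[of _ s])
  next
    case 2
    then obtain ts r where "s = plist ts r" "ts \<noteq> []" "\<exists>t \<in> HU F. last ts = t \<ominus> t"
      unfolding L1_def by blast
    then show ?thesis unfolding L1_def using HU
      by (auto intro!: exI[of _ "x # ts"] exI[of _ r])
  qed
qed

section \<open>The ground instances of the program\<close>

lemma herbrand_model_closed:
  assumes "herbrand_model F Q P I" "range \<theta> \<subseteq> HU F" "c \<in> P"
    and "\<forall>a \<in> set (body c). subst_atom \<theta> a \<in> I"
  shows "subst_atom \<theta> (head c) \<in> I"
proof -
  have "subst_atom \<theta> (head c) \<Longleftarrow> map (subst_atom \<theta>) (body c) \<in> ground_instances F P"
    using assms(2,3) unfolding ground_instances_def by blast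
  then show ?thesis
    using assms(1,4) unfolding herbrand_model_def by fastforce
qed

text \<open>A substitution matters only through its values on the variables of a clause, and these
  can be arbitrary ground terms. Quantifiers over substitutions thus become quantifiers over
  \<open>HU F\<close>.\<close>

lemma herbrand_model_P3_iff:
  assumes "P3_fsyms \<subseteq> F"
  shows "herbrand_model F Q P3 I \<longleftrightarrow>
    I \<subseteq> HB F Q \<and>
    Atom Sat_cnf [nil_t] \<in> I \<and>
    (\<forall>c \<in> HU F. \<forall>cs \<in> HU F. Atom Sat_cl [c] \<in> I \<and> Atom Sat_cnf [cs] \<in> I \<longrightarrow>
      Atom Sat_cnf [c \<bullet> cs] \<in> I) \<and>
    (\<forall>p \<in> HU F. \<forall>v \<in> HU F. \<forall>r \<in> HU F. Atom Sat_cl3 [r, v, p] \<in> I \<longrightarrow>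
      Atom Sat_cl [(p \<ominus> v) \<bullet> r] \<in> I) \<and>
    (\<forall>x \<in> HU F. Atom Equal [x, x] \<in> I) \<and>
    (\<forall>p \<in> HU F. \<forall>v \<in> HU F. Atom Equal [v, p] \<in> I \<longrightarrow> Atom Sat_cl3 [nil_t, v, p] \<in> I) \<and>
    (\<forall>v1 \<in> HU F. \<forall>p1 \<in> HU F. \<forall>v2 \<in> HU F. \<forall>p2 \<in> HU F. \<forall>r \<in> HU F.
      (Atom Sat_cl5 [v1, p1, v2, p2, r] \<in> I \<longrightarrow>
        Atom Sat_cl3 [(p2 \<ominus> v2) \<bullet> r, v1, p1] \<in> I) \<and>
      (Atom Sat_cl5a [v1, p1, v2, p2, r] \<in> I \<longrightarrow> Atom Sat_cl5 [v1, p1, v2, p2, r] \<in> I) \<and>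
      (Atom Sat_cl5a [v2, p2, v1, p1, r] \<in> I \<longrightarrow> Atom Sat_cl5 [v1, p1, v2, p2, r] \<in> I) \<and>
      (Atom Equal [v1, p1] \<in> I \<longrightarrow> Atom Sat_cl5a [v1, p1, v2, p2, r] \<in> I) \<and>
      (Atom Sat_cl3 [r, v2, p2] \<in> I \<longrightarrow> Atom Sat_cl5a [v1, p1, v2, p2, r] \<in> I)) \<and>
    (\<forall>cs \<in> HU F. \<forall>vs \<in> HU F. Atom Sat_cnf [cs] \<in> I \<and> Atom Tflist [vs] \<in> I \<longrightarrow>
      Atom Sat [cs, vs] \<in> I) \<and>
    Atom Tflist [nil_t] \<in> I \<and>
    (\<forall>v \<in> HU F. \<forall>vs \<in> HU F. Atom Tflist [vs] \<in> I \<and> Atom Tf [v] \<in> I \<longrightarrow>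
      Atom Tflist [v \<bullet> vs] \<in> I) \<and>
    Atom Tf [true_t] \<in> I \<and> Atom Tf [false_t] \<in> I" (is "_ \<longleftrightarrow> ?closed")
proof
  assume model: "herbrand_model F Q P3 I"
  have sub: "I \<subseteq> HB F Q"
    and all: "\<And>\<theta>. range \<theta> \<subseteq> HU F \<Longrightarrow>
      \<forall>c \<in> P3. (\<forall>a \<in> set (body c). subst_atom \<theta> a \<in> I) \<longrightarrow> subst_atom \<theta> (head c) \<in> I"
    using model herbrand_model_closed[OF model] by (auto simp: herbrand_model_def)
  \<comment> \<open>A ground default value for the variables that the substitution below does not
    mention: its whole range must lie in \<open>HU F\<close>.\<close>
  have nil: "nil_t \<in> HU F" using P3_fsyms_HU assms by blast
  have upd: "range (\<theta>(x := t)) \<subseteq> HU F" if "range \<theta> \<subseteq> HU F" "t \<in> HU F" for \<theta> x t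
    using that by auto
  \<comment> \<open>One substitution serves all clauses; variables given the same value never occur together in a clause.\<close>
  define \<theta> :: "'a trm \<Rightarrow> 'a trm \<Rightarrow> 'a trm \<Rightarrow> 'a trm \<Rightarrow> 'a trm \<Rightarrow> string \<Rightarrow> 'a trm"
    where "\<theta> a b c d e = (\<lambda>_. nil_t)
      (''V'' := a, ''P'' := b, ''R'' := e, ''X'' := a, ''C'' := a, ''Cs'' := b, ''Vs'' := c,
       ''V1'' := a, ''P1'' := b, ''V2'' := c, ''P2'' := d)" for a b c d e
  have ran: "range (\<theta> a b c d e) \<subseteq> HU F"
    if "a \<in> HU F" "b \<in> HU F" "c \<in> HU F" "d \<in> HU F" "e \<in> HU F" for a b c d e
    unfolding \<theta>_def by (intro upd that) (use nil in auto)
  note inst = all[OF ran, unfolded P3_def Let_def ball_simps clause.sel list.set, simplified,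
      unfolded \<theta>_def, simplified]
  show ?closed
    by (intro conjI ballI impI; (rule sub | use inst nil in metis))
next
  assume closed: ?closed
  have "subst_atom \<theta> (head c) \<in> I"
    if "c \<in> P3" "range \<theta> \<subseteq> HU F" "set (map (subst_atom \<theta>) (body c)) \<subseteq> I" for c \<theta>
  proof -
    have "\<And>x. \<theta> x \<in> HU F" using that(2) by blast
    then show ?thesis
      using that(1,3) closed unfolding P3_def Let_def insert_iff empty_iff
      by (elim disjE) simp_all
  qed
  with closed show "herbrand_model F Q P3 I"
    unfolding herbrand_model_def ground_instances_def by auto
qed

text \<open>Distinct predicate symbols make the sets united in \<open>spec\<close> disjoint, so only
  one of them can contain a given atom.\<close>

lemma spec_simps:
  "Atom Sat_cl [s] \<in> spec F A B \<longleftrightarrow> s \<in> A"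
  "Atom Sat_cnf [s] \<in> spec F A B \<longleftrightarrow> s \<in> B"
  "Atom Equal [s, t] \<in> spec F A B \<longleftrightarrow> s = t \<and> t \<in> HU F"
  "Atom Sat_cl3 [s, v, p] \<in> spec F A B \<longleftrightarrow> (p \<ominus> v) \<bullet> s \<in> A"
  "Atom Sat_cl5 [v1, p1, v2, p2, s] \<in> spec F A B \<longleftrightarrow> (p1 \<ominus> v1) \<bullet> (p2 \<ominus> v2) \<bullet> s \<in> A"
  "Atom Sat_cl5a [v1, p1, v2, p2, s] \<in> spec F A B \<longleftrightarrow> (p1 \<ominus> v1) \<bullet> (p2 \<ominus> v2) \<bullet> s \<in> A"
  "Atom Sat [s, t] \<in> spec F A B \<longleftrightarrow> s \<in> B \<and> t \<in> TFL"
  "Atom Tflist [t] \<in> spec F A B \<longleftrightarrow> t \<in> TFL"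
  "Atom Tf [t] \<in> spec F A B \<longleftrightarrow> t = true_t \<or> t = false_t"
  by (auto simp: spec_def)

section \<open>Correctness\<close>

lemma S3_subset_HB:
  assumes "P3_fsyms \<subseteq> F" and "P3_psyms \<subseteq> Q"
  shows "S3 F \<subseteq> HB F Q"
proof -
  note HU = P3_fsyms_HU[OF assms(1)]
  have HB: "Atom p ts \<in> HB F Q \<longleftrightarrow> (p, length ts) \<in> Q \<and> set ts \<subseteq> HU F" for p ts
    by (auto simp: HB_def)
  have L1: "s \<in> HU F" if "s \<in> L1 F" for s
    using that L1_subset_HU by blast
  have L2: "s \<in> HU F" if "s \<in> L2 F" for s
    using that plists_of_subset_HU[OF assms(1) L1_subset_HU] unfolding L2_def by blast
  have TFL: "s \<in> HU F" if "s \<in> TFL" for s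
    using that plists_of_subset_HU[OF assms(1), of "{true_t, false_t}"] HU
    unfolding TFL_def by blast
  \<comment> \<open>Some arguments occur in the specification only inside a list in
    \<open>L1\<close>, so their groundness is read off from that list.\<close>
  have cl3: "p \<in> HU F \<and> v \<in> HU F \<and> s \<in> HU F" if "(p \<ominus> v) \<bullet> s \<in> L1 F" for p v s
    using L1[OF that] HU(4,5) by simp
  have cl5: "p1 \<in> HU F \<and> v1 \<in> HU F \<and> p2 \<in> HU F \<and> v2 \<in> HU F \<and> s \<in> HU F"
    if "(p1 \<ominus> v1) \<bullet> (p2 \<ominus> v2) \<bullet> s \<in> L1 F" for p1 v1 p2 v2 s
    using L1[OF that] HU(4,5) by simp
  have Q: "(Sat_cl, Suc 0) \<in> Q" "(Sat_cnf, Suc 0) \<in> Q" "(Equal, Suc (Suc 0)) \<in> Q"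
    "(Sat_cl3, Suc (Suc (Suc 0))) \<in> Q" "(Sat_cl5, Suc (Suc (Suc (Suc (Suc 0))))) \<in> Q"
    "(Sat_cl5a, Suc (Suc (Suc (Suc (Suc 0))))) \<in> Q" "(Sat, Suc (Suc 0)) \<in> Q"
    "(Tflist, Suc 0) \<in> Q" "(Tf, Suc 0) \<in> Q"
    using assms(2) by (simp_all add: P3_psyms_def eval_nat_numeral)
  show ?thesis
    unfolding S3_def spec_def Un_subset_iff
    by (intro conjI subsetI) (auto simp: HB Q HU(2,3) L1 L2 TFL dest: cl3 cl5)
qed

text \<open>Passing from \<open>Sat_cl5\<close> to \<open>Sat_cl3\<close> or from
  \<open>Sat_cl3\<close> to \<open>Sat_cl\<close> keeps the underlying list; one
  \<open>Sat_cl5\<close> clause swaps its first two elements; the \<open>Sat_cl5a\<close> clauses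
  either supply an equal first pair or put a pair in front of a list in \<open>L1\<close>.\<close>

lemma herbrand_model_S3:
  assumes "P3_fsyms \<subseteq> F" and "P3_psyms \<subseteq> Q"
  shows "herbrand_model F Q P3 (S3 F)"
  using S3_subset_HB[OF assms]
  unfolding herbrand_model_P3_iff[OF assms(1)] S3_def spec_simps L2_def TFL_def
  by (auto simp: cons_in_L1_iff[OF assms(1)] P3_fsyms_HU[OF assms(1)]
      nil_in_plists_of cons_in_plists_of)

section \<open>Completeness\<close>

text \<open>Splits off the first pair, which \<open>Sat_cl3\<close> carries as separate arguments.
  That pair may be the only one with equal components, so the last condition ranges over
  \<open>(p, v) # ps\<close>.\<close>

lemma L1_0_E:
  assumes "P3_fsyms \<subseteq> F" "s \<in> L1_0 F"
  obtains p v ps where "s = (p \<ominus> v) \<bullet> plist (map (\<lambda>(t, t'). t \<ominus> t') ps) nil_t"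
    "set ((p, v) # ps) \<subseteq> HU F \<times> HU F" "\<exists>(t, t') \<in> set ((p, v) # ps). t = t'"
proof -
  from assms(2) obtain qs where qs: "s = plist (map (\<lambda>(t, t'). t \<ominus> t') qs) nil_t"
      "s \<in> HU F" "qs \<noteq> []" "\<exists>(t, t') \<in> set qs. t = t'"
    unfolding L1_0_def by blast
  from qs(1,2) have "set qs \<subseteq> HU F \<times> HU F"
    using P3_fsyms_HU(5)[OF assms(1)] by (fastforce simp: plist_in_HU_iff[OF assms(1)])
  moreover obtain p v ps where "qs = (p, v) # ps"
    using qs(3) by (metis list.exhaust surj_pair)
  ultimately show thesis
    using qs(1,4) that[of p v ps] by simp
qed

lemma L1_0_subset_HU: "L1_0 F \<subseteq> HU F"
  by (auto simp: L1_0_def)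

lemma S3_0_subset_model:
  assumes "P3_fsyms \<subseteq> F" and model: "herbrand_model F Q P3 I"
  shows "S3_0 F \<subseteq> I"
proof -
  let ?pl = "\<lambda>ps. plist (map (\<lambda>(t, t'). t \<ominus> t') ps) nil_t"
  note closed = model[unfolded herbrand_model_P3_iff[OF assms(1)]]
  note HU = P3_fsyms_HU[OF assms(1)]
  have eq: "\<And>t. t \<in> HU F \<Longrightarrow> Atom Equal [t, t] \<in> I" using closed by blast
  have pl: "?pl ps \<in> HU F" if "set ps \<subseteq> HU F \<times> HU F" for ps
    using that HU by (auto simp: plist_in_HU_iff[OF assms(1)])
  have cl3: "Atom Sat_cl3 [?pl ps, v, p] \<in> I"
    if "set ((p, v) # ps) \<subseteq> HU F \<times> HU F" "\<exists>(t, t') \<in> set ((p, v) # ps). t = t'" for p v ps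
    using that
  \<comment> \<open>\<open>p\<close> and \<open>v\<close> are generalized because descending into
    the list makes its next pair the current one.\<close>
  proof (induction ps arbitrary: p v)
    case Nil
    then have "Atom Equal [v, p] \<in> I" using eq by auto
    with Nil closed show ?case by auto
  next
    case (Cons q ps)
    obtain p2 v2 where q: "q = (p2, v2)" by fastforce
    have mem: "v \<in> HU F" "p \<in> HU F" "v2 \<in> HU F" "p2 \<in> HU F" "?pl ps \<in> HU F"
      using Cons.prems q pl by auto
    \<comment> \<open>The disjuncts are the bodies of the two \<open>Sat_cl5a\<close> clauses:
      either the current pair has equal components, or such a pair comes later and the induction
      hypothesis applies.\<close>
    have "Atom Equal [v, p] \<in> I \<or> Atom Sat_cl3 [?pl ps, v2, p2] \<in> I"
    proof (cases "p = v")
      case True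
      then show ?thesis using eq mem by auto
    next
      case False
      then show ?thesis using Cons q by auto
    qed
    then have "Atom Sat_cl5a [v, p, v2, p2, ?pl ps] \<in> I"
      using closed mem by blast
    then have "Atom Sat_cl5 [v, p, v2, p2, ?pl ps] \<in> I"
      using closed mem by blast
    then have "Atom Sat_cl3 [(p2 \<ominus> v2) \<bullet> ?pl ps, v, p] \<in> I"
      using closed mem by blast
    then show ?case using q by simp
  qed
  have cl3': "Atom Sat_cl3 [s, v, p] \<in> I" if "(p \<ominus> v) \<bullet> s \<in> L1_0 F" for s v p
  proof -
    from assms(1) that obtain p' v' ps where "(p \<ominus> v) \<bullet> s = (p' \<ominus> v') \<bullet> ?pl ps"
      "set ((p', v') # ps) \<subseteq> HU F \<times> HU F" "\<exists>(t, t') \<in> set ((p', v') # ps). t = t'"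
      by (rule L1_0_E)
    then show ?thesis using cl3[of p' v' ps] by simp
  qed
  have cl: "Atom Sat_cl [s] \<in> I" if s: "s \<in> L1_0 F" for s
  proof -
    from assms(1) s obtain p v r where s': "s = (p \<ominus> v) \<bullet> r" by (rule L1_0_E)
    have "p \<in> HU F" "v \<in> HU F" "r \<in> HU F"
      using s L1_0_subset_HU[of F] HU(4,5) unfolding s' by auto
    then show ?thesis using closed cl3'[of p v r] s unfolding s' by blast
  qed
  have cl5a: "Atom Sat_cl5a [v1, p1, v2, p2, s] \<in> I"
      and mem5: "v1 \<in> HU F" "p1 \<in> HU F" "v2 \<in> HU F" "p2 \<in> HU F" "s \<in> HU F"
    if s: "(p1 \<ominus> v1) \<bullet> (p2 \<ominus> v2) \<bullet> s \<in> L1_0 F" for v1 p1 v2 p2 s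
  proof -
    show mem: "v1 \<in> HU F" "p1 \<in> HU F" "v2 \<in> HU F" "p2 \<in> HU F" "s \<in> HU F"
      using s L1_0_subset_HU[of F] HU(4,5) by auto
    from assms(1) s obtain p v ps where
      *: "(p1 \<ominus> v1) \<bullet> (p2 \<ominus> v2) \<bullet> s = (p \<ominus> v) \<bullet> ?pl ps"
        "set ((p, v) # ps) \<subseteq> HU F \<times> HU F" "\<exists>(t, t') \<in> set ((p, v) # ps). t = t'"
      by (rule L1_0_E)
    then have ps: "(p2 \<ominus> v2) \<bullet> s = ?pl ps" "set ((p1, v1) # ps) \<subseteq> HU F \<times> HU F"
        "\<exists>(t, t') \<in> set ((p1, v1) # ps). t = t'"
      by simp_all
    \<comment> \<open>\<open>ps\<close> cannot be empty: its list term equals a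
      \<open>\<bullet>\<close> term, not \<open>nil_t\<close>.\<close>
    then obtain qs where qs: "ps = (p2, v2) # qs" "s = ?pl qs"
      by (cases ps) auto
    have "Atom Equal [v1, p1] \<in> I \<or> Atom Sat_cl3 [s, v2, p2] \<in> I"
    proof (cases "p1 = v1")
      case True
      then show ?thesis using eq mem by auto
    next
      case False
      then show ?thesis using ps(2,3) cl3[of p2 v2 qs] unfolding qs by auto
    qed
    then show "Atom Sat_cl5a [v1, p1, v2, p2, s] \<in> I"
      using closed mem by blast
  qed
  have cl5: "Atom Sat_cl5 [v1, p1, v2, p2, s] \<in> I"
    if "(p1 \<ominus> v1) \<bullet> (p2 \<ominus> v2) \<bullet> s \<in> L1_0 F" for v1 p1 v2 p2 s
    using cl5a[OF that] mem5[OF that] closed by blast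
  \<comment> \<open>Groundness is carried through the induction because the recursive
    \<open>Sat_cnf\<close> clause and the \<open>Sat\<close> clause are available only for terms of
    \<open>HU F\<close>.\<close>
  have cnf: "u \<in> HU F \<and> Atom Sat_cnf [u] \<in> I" if "u \<in> L2_0 F" for u
    using that unfolding L2_0_def
  proof (induction rule: plists_of_induct)
    case nil
    show ?case using closed HU(1) by blast
  next
    case (cons s t)
    have s: "s \<in> HU F" "Atom Sat_cl [s] \<in> I" using cons(1) L1_0_subset_HU cl by auto
    then have "Atom Sat_cnf [s \<bullet> t] \<in> I" using cons(3) closed by metis
    then show ?case using cons(3) s HU(4) by simp
  qed
  have tf: "Atom Tf [true_t] \<in> I" "Atom Tf [false_t] \<in> I"
    using closed by blast+
  have tfl: "t \<in> HU F \<and> Atom Tflist [t] \<in> I" if "t \<in> TFL" for t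
    using that unfolding TFL_def
  proof (induction rule: plists_of_induct)
    case nil
    show ?case using closed HU(1) by blast
  next
    case (cons s t)
    have s: "s \<in> HU F" "Atom Tf [s] \<in> I" using cons(1) tf HU(2,3) by auto
    then have "Atom Tflist [s \<bullet> t] \<in> I" using cons(3) closed by metis
    then show ?case using cons(3) s HU(4) by simp
  qed
  have "Atom Sat [u, t] \<in> I" if "u \<in> L2_0 F" "t \<in> TFL" for u t
    using closed cnf[OF that(1)] tfl[OF that(2)] by blast
  then show ?thesis
    unfolding S3_0_def spec_def using eq cl cl3' cl5 cl5a cnf tf tfl by auto
qed

theorem mainTheorem2:
  fixes F :: "('f fsym \<times> nat) set" and Q :: "('p psym \<times> nat) set"
  assumes "P3_fsyms \<subseteq> F" and "P3_psyms \<subseteq> Q"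
  shows "correct_wrt F Q P3 (S3 F) \<and> complete_wrt F Q P3 (S3_0 F)"
  \<comment> \<open>\<open>S3 F\<close> is one of the intersected models, hence contains the
    intersection; \<open>S3_0 F\<close> lies in each of them, hence in the intersection.\<close>
  using herbrand_model_S3[OF assms] S3_0_subset_model[OF assms(1)]
  unfolding correct_wrt_def complete_wrt_def least_herbrand_model_def by blast

end
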